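(* If a key-invariant LocalMax GNN whose combination functions are all continuous expresses a node query $\mathcal{Q}$, then the complement $\mathcal{Q}^c$ is closed under functional bisimulations: whenever $G^u\in\mathcal{Q}^c$ and there is a functional bisimulation from $G^u$ to $H^v$, also $H^v\in\mathcal{Q}^c$.
   Context: Fix a finite set $\Pi=\{p_1,\dots,p_n\}$ of propositions. A graph is $G=(V,E,\mathrm{lab})$ with $V$ finite, $E\subseteq V\times V$ irreflexive and symmetric, $\mathrm{lab}:V\to\{0,1\}^n$. A pointed graph $G^u$ has a distinguished node $u$. A node query is an isomorphism-closed class of pointed graphs (isomorphisms preserve labels, edges both ways, and the distinguished node); $\mathcal{Q}^c$ is its complement. A keyed extension of $G^u$ is $G^u$ together with an injective map $\mathrm{key}:V\to\mathbb{R}$. A GNN is a sequence of layers $(\mathrm{agg}_i,\mathrm{com}_i)_{i=1}^\ell$, $\mathrm{agg}_i$ mapping finite multisets over $\mathbb{R}^{D_i}$ to $\mathbb{R}^{D_i}$, $\mathrm{com}_i:\mathbb{R}^{2D_i}\to\mathbb{R}^{D_{i+1}}$, $D_1=n+1$, $D_{\ell+1}=1$. On a keyed graph, the initial embedding is $\mathrm{emb}(v)=\mathrm{lab}(v)\oplus(\mathrm{key}(v))$, each layer computes $\mathrm{emb}'(u)=\mathrm{com}_i(\mathrm{emb}(u),\mathrm{agg}_i(\{\!\{\mathrm{emb}(v)\mid (u,v)\in E\}\!\}))$, and the output is the final value at the distinguished node. In a LocalMax GNN each $\mathrm{agg}_i$ is coordinate-wise maximum (maximum of the empty multiset is $0$).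 The GNN accepts a keyed pointed graph if its output is $>0$ and rejects otherwise. It is key-invariant if, for every pointed graph, either all its keyed extensions are accepted or all are rejected; it then expresses the node query of pointed graphs whose keyed extensions are accepted. A bisimulation between $G^u$ and $H^v$ is a relation $B\subseteq V(G)\times V(H)$ with $(u,v)\in B$ such that whenever $(u_0,v_0)\in B$: $u_0,v_0$ have the same label; every neighbor $u_1$ of $u_0$ has a neighbor $v_1$ of $v_0$ with $(u_1,v_1)\in B$; and every neighbor $v_1$ of $v_0$ has a neighbor $u_1$ of $u_0$ with $(u_1,v_1)\in B$. A functional bisimulation from $G^u$ to $H^v$ is a bisimulation $B$ such that every $u_0\in V(G)$ is related to exactly one node of $H$. *)

theory Defs
  imports "HOL-Analysis.Abstract_Euclidean_Space" "HOL-Library.Multiset"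
begin

text \<open>Values of \<open>lab\<close> outside \<open>verts\<close> are unconstrained; node queries cannot depend on them,
  since isomorphisms ignore them.\<close>

record 'v lgraph =
  verts :: "'v set"
  edges :: "('v \<times> 'v) set"
  lab :: "'v \<Rightarrow> bool list"

definition lgraph :: "nat \<Rightarrow> 'v lgraph \<Rightarrow> bool" where
  "lgraph n G \<longleftrightarrow>
     finite (verts G) \<and> edges G \<subseteq> verts G \<times> verts G \<and> irrefl (edges G) \<and> sym (edges G) \<and>
     (\<forall>v\<in>verts G. length (lab G v) = n)"

definition pointed_graphs :: "nat \<Rightarrow> ('v lgraph \<times> 'v) set" where
  "pointed_graphs n = {(G, u). lgraph n G \<and> u \<in> verts G}"

definition pointed_iso :: "('v \<Rightarrow> 'w) \<Rightarrow> 'v lgraph \<times> 'v \<Rightarrow> 'w lgraph \<times> 'w \<Rightarrow> bool" where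
  "pointed_iso f = (\<lambda>(G, u) (H, v).
     bij_betw f (verts G) (verts H) \<and>
     (\<forall>x\<in>verts G. lab H (f x) = lab G x) \<and>
     (\<forall>x\<in>verts G. \<forall>y\<in>verts G. (x, y) \<in> edges G \<longleftrightarrow> (f x, f y) \<in> edges H) \<and>
     f u = v)"

definition node_query :: "nat \<Rightarrow> ('v lgraph \<times> 'v) set \<Rightarrow> bool" where
  "node_query n Q \<longleftrightarrow>
     Q \<subseteq> pointed_graphs n \<and>
     (\<forall>P\<in>Q. \<forall>P'\<in>pointed_graphs n. (\<exists>f. pointed_iso f P P') \<longrightarrow> P' \<in> Q)"

definition query_compl :: "nat \<Rightarrow> ('v lgraph \<times> 'v) set \<Rightarrow> ('v lgraph \<times> 'v) set" where
  "query_compl n Q = pointed_graphs n - Q"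

definition keying :: "'v lgraph \<Rightarrow> ('v \<Rightarrow> real) \<Rightarrow> bool" where
  "keying G key \<longleftrightarrow> inj_on key (verts G)"

definition bisimulation ::
    "('v \<times> 'w) set \<Rightarrow> 'v lgraph \<times> 'v \<Rightarrow> 'w lgraph \<times> 'w \<Rightarrow> bool" where
  "bisimulation B = (\<lambda>(G, u) (H, v).
     B \<subseteq> verts G \<times> verts H \<and> (u, v) \<in> B \<and>
     (\<forall>(u0, v0)\<in>B.
        lab G u0 = lab H v0 \<and>
        (\<forall>u1. (u0, u1) \<in> edges G \<longrightarrow> (\<exists>v1. (v0, v1) \<in> edges H \<and> (u1, v1) \<in> B)) \<and>
        (\<forall>v1. (v0, v1) \<in> edges H \<longrightarrow> (\<exists>u1. (u0, u1) \<in> edges G \<and> (u1, v1) \<in> B))))"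

definition functional_bisimulation ::
    "('v \<times> 'w) set \<Rightarrow> 'v lgraph \<times> 'v \<Rightarrow> 'w lgraph \<times> 'w \<Rightarrow> bool" where
  "functional_bisimulation B P P' \<longleftrightarrow>
     bisimulation B P P' \<and> (\<forall>u0\<in>verts (fst P). \<exists>!v0. (u0, v0) \<in> B)"

definition closed_under_functional_bisimulations ::
    "nat \<Rightarrow> ('v lgraph \<times> 'v) set \<Rightarrow> bool" where
  "closed_under_functional_bisimulations n C \<longleftrightarrow>
     (\<forall>P\<in>C. \<forall>P'\<in>pointed_graphs n. (\<exists>B. functional_bisimulation B P P') \<longrightarrow> P' \<in> C)"

text \<open>The space \<open>\<real>\<^sup>D\<close>, with \<open>D\<close> varying from layer to layer, is \<^term>\<open>Euclidean_space D\<close>: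
  functions \<^typ>\<open>nat \<Rightarrow> real\<close> that vanish at all indices \<open>\<ge> D\<close>, with the product topology.\<close>

type_synonym vec = "nat \<Rightarrow> real"

abbreviation rvec :: "nat \<Rightarrow> vec set" where
  "rvec D \<equiv> topspace (Euclidean_space D)"

definition vec_append :: "nat \<Rightarrow> vec \<Rightarrow> vec \<Rightarrow> vec" where
  "vec_append D x y = (\<lambda>i. if i < D then x i else y (i - D))"

record gnn_layer =
  in_dim :: nat
  out_dim :: nat
  agg :: "vec multiset \<Rightarrow> vec"
  com :: "vec \<Rightarrow> vec"

definition gnn_layer :: "gnn_layer \<Rightarrow> bool" where
  "gnn_layer L \<longleftrightarrow>
     (\<forall>M. set_mset M \<subseteq> rvec (in_dim L) \<longrightarrow> agg L M \<in> rvec (in_dim L)) \<and>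
     com L \<in> rvec (2 * in_dim L) \<rightarrow> rvec (out_dim L)"

fun dims_chain :: "nat \<Rightarrow> gnn_layer list \<Rightarrow> nat \<Rightarrow> bool" where
  "dims_chain D [] D' \<longleftrightarrow> D = D'"
| "dims_chain D (L # Ls) D' \<longleftrightarrow> in_dim L = D \<and> dims_chain (out_dim L) Ls D'"

definition gnn :: "nat \<Rightarrow> gnn_layer list \<Rightarrow> bool" where
  "gnn n Ls \<longleftrightarrow> (\<forall>L\<in>set Ls. gnn_layer L) \<and> dims_chain (n + 1) Ls 1"

definition coord_max :: "vec multiset \<Rightarrow> vec" where
  "coord_max M = (\<lambda>i. if M = {#} then 0 else Max_mset (image_mset (\<lambda>x. x i) M))"

definition local_max :: "gnn_layer list \<Rightarrow> bool" where
  "local_max Ls \<longleftrightarrow>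
     (\<forall>L\<in>set Ls. \<forall>M. set_mset M \<subseteq> rvec (in_dim L) \<longrightarrow> agg L M = coord_max M)"

definition continuous_combinations :: "gnn_layer list \<Rightarrow> bool" where
  "continuous_combinations Ls \<longleftrightarrow>
     (\<forall>L\<in>set Ls.
        continuous_map (Euclidean_space (2 * in_dim L)) (Euclidean_space (out_dim L)) (com L))"

definition init_emb :: "nat \<Rightarrow> 'v lgraph \<Rightarrow> ('v \<Rightarrow> real) \<Rightarrow> 'v \<Rightarrow> vec" where
  "init_emb n G key v =
     (\<lambda>i. if i < n then of_bool (lab G v ! i) else if i = n then key v else 0)"

definition layer_step :: "'v lgraph \<Rightarrow> gnn_layer \<Rightarrow> ('v \<Rightarrow> vec) \<Rightarrow> 'v \<Rightarrow> vec" where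
  "layer_step G L emb u =
     com L (vec_append (in_dim L) (emb u)
       (agg L (image_mset emb (mset_set {v. (u, v) \<in> edges G}))))"

definition gnn_output ::
    "nat \<Rightarrow> gnn_layer list \<Rightarrow> 'v lgraph \<times> 'v \<Rightarrow> ('v \<Rightarrow> real) \<Rightarrow> real" where
  "gnn_output n Ls = (\<lambda>(G, u) key. fold (layer_step G) Ls (init_emb n G key) u 0)"

definition accepts ::
    "nat \<Rightarrow> gnn_layer list \<Rightarrow> 'v lgraph \<times> 'v \<Rightarrow> ('v \<Rightarrow> real) \<Rightarrow> bool" where
  "accepts n Ls P key \<longleftrightarrow> gnn_output n Ls P key > 0"

text \<open>Graphs take their vertices from a type \<open>'v\<close>; any infinite \<open>'v\<close>
  contains an isomorphic copy of every finite graph.\<close>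

definition key_invariant :: "'v itself \<Rightarrow> nat \<Rightarrow> gnn_layer list \<Rightarrow> bool" where
  "key_invariant _ n Ls \<longleftrightarrow>
     (\<forall>P\<in>(pointed_graphs n :: ('v lgraph \<times> 'v) set).
        (\<forall>key. keying (fst P) key \<longrightarrow> accepts n Ls P key) \<or>
        (\<forall>key. keying (fst P) key \<longrightarrow> \<not> accepts n Ls P key))"

definition expresses :: "nat \<Rightarrow> gnn_layer list \<Rightarrow> ('v lgraph \<times> 'v) set \<Rightarrow> bool" where
  "expresses n Ls Q \<longleftrightarrow>
     Q = {P \<in> pointed_graphs n. \<forall>key. keying (fst P) key \<longrightarrow> accepts n Ls P key}"

end

theory Submission
  imports Defs
begin

text \<open>Maximum aggregation sees only the set of neighbour embeddings. Hence if \<open>G\<close> carries the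
  keys of \<open>H\<close> pulled back along the functional bisimulation, the network computes the same value
  at corresponding nodes of \<open>G\<close> and \<open>H\<close>. The pulled-back keys need not be injective, but
  arbitrarily small perturbations of them are; since the output depends continuously on the keys,
  a positive output survives such a perturbation. So if \<open>H\<^sup>v\<close> is accepted, then some keyed
  extension of \<open>G\<^sup>u\<close> is accepted.\<close>

section \<open>Concatenation and maximum in \<open>Euclidean_space\<close>, and their
  continuity\<close>

lemma continuous_map_Euclidean_space_componentwise:
  "continuous_map X (Euclidean_space D) f \<longleftrightarrow>
     (\<forall>i. continuous_map X euclideanreal (\<lambda>x. f x i)) \<and> f \<in> topspace X \<rightarrow> rvec D"
  by (auto simp: Euclidean_space_def continuous_map_in_subtopology
      continuous_map_componentwise_UNIV)

lemma vec_append_in_rvec: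
  assumes "y \<in> rvec E"
  shows "vec_append D x y \<in> rvec (D + E)"
  using assms by (auto simp: topspace_Euclidean_space vec_append_def)

lemma continuous_map_vec_append:
  assumes "continuous_map X (Euclidean_space D) f" "continuous_map X (Euclidean_space E) g"
  shows "continuous_map X (Euclidean_space (D + E)) (\<lambda>x. vec_append D (f x) (g x))"
  using assms vec_append_in_rvec[of _ E D]
  by (auto simp: continuous_map_Euclidean_space_componentwise vec_append_def Pi_iff)

text \<open>This form depends on \<open>M\<close> only through \<open>set_mset M\<close>, which is
  what makes multiplicities irrelevant when neighbourhoods are compared later.\<close>

lemma coord_max_eq:
  "coord_max M = (\<lambda>i. if set_mset M = {} then 0 else Max ((\<lambda>x. x i) ` set_mset M))"
  by (simp add: coord_max_def fun_eq_iff)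

lemma coord_max_in_rvec:
  assumes "set_mset M \<subseteq> rvec D"
  shows "coord_max M \<in> rvec D"
proof -
  \<comment> \<open>From index \<open>D\<close> on every vector vanishes, so the maximum is taken
    over the single value 0; the default for the empty multiset is 0 as well.\<close>
  have "coord_max M i = 0" if "i \<ge> D" for i
  proof (cases "set_mset M = {}")
    case False
    moreover have "(\<lambda>x. x i) ` set_mset M = (\<lambda>x. 0) ` set_mset M"
      using assms that by (intro image_cong) (auto simp: topspace_Euclidean_space)
    ultimately show ?thesis
      unfolding coord_max_eq by simp
  qed (simp add: coord_max_eq)
  then show ?thesis
    by (simp add: topspace_Euclidean_space)
qed

text \<open>A finite maximum is an iterated binary \<open>max\<close>, so continuity follows by
  induction from a singleton.\<close>

lemma continuous_map_Max:
  fixes f :: "'a \<Rightarrow> 'b \<Rightarrow> real"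
  assumes "finite N" "N \<noteq> {}" "\<And>y. y \<in> N \<Longrightarrow> continuous_map X euclideanreal (f y)"
  shows "continuous_map X euclideanreal (\<lambda>x. Max ((\<lambda>y. f y x) ` N))"
  using assms
proof (induction N rule: finite_ne_induct)
  case (insert y N)
  then have "(\<lambda>x. Max ((\<lambda>y. f y x) ` insert y N)) = (\<lambda>x. max (f y x) (Max ((\<lambda>y. f y x) ` N)))"
    by simp
  with insert show ?case
    by (simp add: continuous_map_real_max)
qed simp

text \<open>The index set \<open>N\<close> is the same for all \<open>x\<close>, so the choice
  between the default 0 and a genuine maximum is made once and causes no jump.\<close>

lemma continuous_map_coord_max:
  assumes "finite N" "\<And>y. y \<in> N \<Longrightarrow> continuous_map X (Euclidean_space D) (f y)"
  shows "continuous_map X (Euclidean_space D)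
           (\<lambda>x. coord_max (image_mset (\<lambda>y. f y x) (mset_set N)))"
proof -
  have "continuous_map X euclideanreal
          (\<lambda>x. coord_max (image_mset (\<lambda>y. f y x) (mset_set N)) i)" for i
  proof (cases "N = {}")
    case True
    then show ?thesis by (simp add: coord_max_eq)
  next
    case False
    have "continuous_map X euclideanreal (\<lambda>x. Max ((\<lambda>y. f y x i) ` N))"
      using assms False
      by (intro continuous_map_Max) (auto simp: continuous_map_Euclidean_space_componentwise)
    then show ?thesis
      using False assms(1) by (simp add: coord_max_eq image_image)
  qed
  moreover have "coord_max (image_mset (\<lambda>y. f y x) (mset_set N)) \<in> rvec D"
    if "x \<in> topspace X" for x
    using assms that
    by (intro coord_max_in_rvec) (auto simp: continuous_map_Euclidean_space_componentwise Pi_iff)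
  ultimately show ?thesis
    by (simp add: continuous_map_Euclidean_space_componentwise Pi_iff)
qed

section \<open>Running the layers on a graph: continuity, and transfer along a map\<close>

lemma neighbours_subset:
  assumes "lgraph n G"
  shows "{y. (x, y) \<in> edges G} \<subseteq> verts G" "finite {y. (x, y) \<in> edges G}"
proof -
  show "{y. (x, y) \<in> edges G} \<subseteq> verts G"
    using assms by (auto simp: lgraph_def)
  then show "finite {y. (x, y) \<in> edges G}"
    using assms by (auto simp: lgraph_def intro: finite_subset)
qed

lemma layer_step_coord_max:
  assumes "lgraph n G" "local_max (L # Ls)"
    and "\<And>y. y \<in> verts G \<Longrightarrow> emb y \<in> rvec (in_dim L)"
  shows "layer_step G L emb x = com L (vec_append (in_dim L) (emb x)
           (coord_max (image_mset emb (mset_set {y. (x, y) \<in> edges G}))))"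
proof -
  have "set_mset (image_mset emb (mset_set {y. (x, y) \<in> edges G})) \<subseteq> rvec (in_dim L)"
    using assms(3) neighbours_subset[OF assms(1), of x] by auto
  then show ?thesis
    using assms(2) by (simp add: layer_step_def local_max_def)
qed

text \<open>\<open>X\<close> is a space of parameters for the initial embedding; it will be the real
  line of perturbation sizes. The induction generalizes \<open>D\<close> and \<open>emb\<close>
  because each layer changes both.\<close>

lemma continuous_map_fold_layer_step:
  assumes "lgraph n G" "local_max Ls" "continuous_combinations Ls" "dims_chain D Ls D'"
    and "\<And>x. x \<in> verts G \<Longrightarrow> continuous_map X (Euclidean_space D) (\<lambda>t. emb t x)"
    and "x \<in> verts G"
  shows "continuous_map X (Euclidean_space D') (\<lambda>t. fold (layer_step G) Ls (emb t) x)"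
  using assms
proof (induction Ls arbitrary: D emb)
  case (Cons L Ls)
  have D: "D = in_dim L"
    using Cons.prems by simp
  have "continuous_map X (Euclidean_space (out_dim L)) (\<lambda>t. layer_step G L (emb t) y)"
    if y: "y \<in> verts G" for y
  proof -
    let ?N = "{z. (y, z) \<in> edges G}"
    have "continuous_map X (Euclidean_space (D + D))
        (\<lambda>t. vec_append D (emb t y) (coord_max (image_mset (emb t) (mset_set ?N))))"
      using Cons.prems(5) y neighbours_subset[OF Cons.prems(1), of y]
      by (intro continuous_map_vec_append continuous_map_coord_max) auto
    moreover have "continuous_map (Euclidean_space (D + D)) (Euclidean_space (out_dim L)) (com L)"
      using Cons.prems(3) D by (simp add: continuous_combinations_def mult_2)
    ultimately have "continuous_map X (Euclidean_space (out_dim L))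
        (\<lambda>t. com L (vec_append D (emb t y) (coord_max (image_mset (emb t) (mset_set ?N)))))"
      using continuous_map_compose[unfolded o_def] by blast
    \<comment> \<open>\<open>local_max\<close> determines \<open>agg\<close> only on multisets over
      \<open>rvec\<close>, so the two functions are compared on \<open>topspace X\<close>, where the
      embeddings are known to lie there.\<close>
    then show ?thesis
    proof (rule continuous_map_eq)
      fix t assume "t \<in> topspace X"
      then have "emb t z \<in> rvec (in_dim L)" if "z \<in> verts G" for z
        using Cons.prems(5)[OF that] D
        by (auto simp: continuous_map_Euclidean_space_componentwise)
      then show "com L (vec_append D (emb t y) (coord_max (image_mset (emb t) (mset_set ?N)))) =
          layer_step G L (emb t) y"
        using layer_step_coord_max[OF Cons.prems(1,2)] D by simp
    qed
  qed
  then show ?case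
    using Cons.IH[of "out_dim L" "\<lambda>t. layer_step G L (emb t)"] Cons.prems
    by (simp add: local_max_def continuous_combinations_def)
qed simp

lemma layer_step_in_rvec:
  assumes "lgraph n G" "gnn_layer L" "\<And>y. y \<in> verts G \<Longrightarrow> emb y \<in> rvec (in_dim L)"
  shows "layer_step G L emb x \<in> rvec (out_dim L)"
proof -
  let ?M = "image_mset emb (mset_set {y. (x, y) \<in> edges G})"
  have "set_mset ?M \<subseteq> rvec (in_dim L)"
    using assms(3) neighbours_subset[OF assms(1), of x] by auto
  then have "agg L ?M \<in> rvec (in_dim L)"
    using assms(2) by (simp add: gnn_layer_def)
  then have "vec_append (in_dim L) (emb x) (agg L ?M) \<in> rvec (2 * in_dim L)"
    unfolding mult_2 by (rule vec_append_in_rvec)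
  then show ?thesis
    using assms(2) by (auto simp: layer_step_def gnn_layer_def)
qed

text \<open>The map \<open>f\<close> may merge neighbours, so corresponding multisets of embeddings
  can differ in multiplicities. By \<open>nbr\<close> their underlying sets coincide, hence so do
  the maxima, layer by layer.\<close>

lemma fold_layer_step_cover:
  assumes "lgraph n G" "lgraph n H"
    and nbr: "\<And>x. x \<in> verts G \<Longrightarrow> f ` {y. (x, y) \<in> edges G} = {w. (f x, w) \<in> edges H}"
    and "local_max Ls" "\<And>L. L \<in> set Ls \<Longrightarrow> gnn_layer L" "dims_chain D Ls D'"
    and "\<And>x. x \<in> verts G \<Longrightarrow> embG x = embH (f x)"
    and "\<And>x. x \<in> verts G \<Longrightarrow> embG x \<in> rvec D" "\<And>y. y \<in> verts H \<Longrightarrow> embH y \<in> rvec D"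
    and "x \<in> verts G"
  shows "fold (layer_step G) Ls embG x = fold (layer_step H) Ls embH (f x)"
  using assms(4-)
proof (induction Ls arbitrary: D embG embH)
  case (Cons L Ls)
  have D: "D = in_dim L"
    using Cons.prems by simp
  note steps = layer_step_coord_max[OF assms(1) Cons.prems(1), of embG]
    layer_step_coord_max[OF assms(2) Cons.prems(1), of embH]
  have "layer_step G L embG z = layer_step H L embH (f z)" if z: "z \<in> verts G" for z
  proof -
    let ?N = "{y. (z, y) \<in> edges G}"
    have "embG ` ?N = embH ` f ` ?N"
      unfolding image_image
      by (rule image_cong) (use Cons.prems(4) neighbours_subset(1)[OF assms(1), of z] in auto)
    then have sets: "set_mset (image_mset embG (mset_set ?N)) =
        set_mset (image_mset embH (mset_set {w. (f z, w) \<in> edges H}))"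
      using neighbours_subset(2)[OF assms(1), of z] neighbours_subset(2)[OF assms(2), of "f z"]
      by (simp add: nbr[OF z])
    have "coord_max (image_mset embG (mset_set ?N)) =
        coord_max (image_mset embH (mset_set {w. (f z, w) \<in> edges H}))"
      by (simp only: coord_max_eq sets)
    then show ?thesis
      using steps Cons.prems(4,5,6) D z by simp
  qed
  moreover have "layer_step G L embG z \<in> rvec (out_dim L)"
      "layer_step H L embH w \<in> rvec (out_dim L)" for z w
    using Cons.prems D layer_step_in_rvec[OF assms(1)] layer_step_in_rvec[OF assms(2)] by auto
  ultimately show ?case
    using Cons.IH[of "out_dim L" "layer_step G L embG" "layer_step H L embH"] Cons.prems
    by (simp add: local_max_def)
qed simp

lemma init_emb_in_rvec: "init_emb n G key x \<in> rvec (n + 1)"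
  by (simp add: topspace_Euclidean_space init_emb_def)

section \<open>Perturbing keys until they are injective\<close>

text \<open>Each pair of distinct points collides for exactly one \<open>t\<close>, and finitely
  many pairs exclude only finitely many values.\<close>

lemma eventually_inj_on_perturbation:
  fixes g k :: "'a \<Rightarrow> real"
  assumes "finite A" "inj_on k A"
  shows "\<forall>\<^sub>F t in at_right 0. inj_on (\<lambda>x. g x + t * k x) A"
proof -
  have "\<forall>\<^sub>F t in at_right 0. x \<noteq> y \<longrightarrow> g x + t * k x \<noteq> g y + t * k y"
    if "x \<in> A" "y \<in> A" for x y
  proof (cases "x = y")
    case False
    then have k: "k x - k y \<noteq> 0"
      using assms(2) that by (auto simp: inj_on_def)
    \<comment> \<open>The quotient is the unique \<open>t\<close> at which the perturbed values at
      \<open>x\<close> and \<open>y\<close> agree. It may be 0 itself, so a punctured neighbourhood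
      is used.\<close>
    have "\<forall>\<^sub>F t in at 0. t \<noteq> (g y - g x) / (k x - k y)"
      by (rule eventually_neq_at_within)
    then have "\<forall>\<^sub>F t in at_right 0. t \<noteq> (g y - g x) / (k x - k y)"
      by (simp add: eventually_at_split)
    then show ?thesis
      by (rule eventually_mono) (use k in \<open>auto simp: field_simps\<close>)
  qed simp
  then have "\<forall>\<^sub>F t in at_right 0. \<forall>x\<in>A. \<forall>y\<in>A. x \<noteq> y \<longrightarrow> g x + t * k x \<noteq> g y + t * k y"
    using assms(1) by (simp add: eventually_ball_finite)
  then show ?thesis
    by (rule eventually_mono) (auto simp: inj_on_def)
qed

lemma finite_imp_keying:
  assumes "finite (verts G)"
  obtains key where "keying G key"
proof -
  obtain h :: "'a \<Rightarrow> nat" where "inj_on h (verts G)"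
    using finite_imp_inj_to_nat_seg[OF assms] by blast
  then have "keying G (\<lambda>x. real (h x))"
    by (auto simp: keying_def inj_on_def)
  then show thesis ..
qed

lemma positive_output_keying:
  assumes "gnn n Ls" "local_max Ls" "continuous_combinations Ls"
    and "(G, u) \<in> pointed_graphs n" "gnn_output n Ls (G, u) g > 0"
  obtains key where "keying G key" "gnn_output n Ls (G, u) key > 0"
proof -
  have G: "lgraph n G" "u \<in> verts G" "finite (verts G)"
    using assms(4) by (auto simp: pointed_graphs_def lgraph_def)
  obtain k where k: "keying G k"
    using finite_imp_keying[OF G(3)] .
  \<comment> \<open>A line of keys that starts at \<open>g\<close>, which may fail to be injective,
    and moves in the injective direction \<open>k\<close>.\<close>
  define key where "key t = (\<lambda>x. g x + t * k x)" for t
  have "continuous_map euclideanreal (Euclidean_space (n + 1)) (\<lambda>t. init_emb n G (key t) x)" for x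
  proof -
    \<comment> \<open>Only coordinate \<open>n\<close>, which holds the key, varies with
      \<open>t\<close>, and it does so affinely.\<close>
    have "continuous_on UNIV (\<lambda>t. init_emb n G (key t) x i)" for i
      by (cases i n rule: linorder_cases)
        (simp_all add: init_emb_def key_def continuous_intros)
    then show ?thesis
      using init_emb_in_rvec[of n G _ x]
      by (simp add: continuous_map_Euclidean_space_componentwise Pi_iff)
  qed
  then have "continuous_map euclideanreal (Euclidean_space 1)
      (\<lambda>t. fold (layer_step G) Ls (init_emb n G (key t)) u)"
    using assms G by (intro continuous_map_fold_layer_step) (auto simp: gnn_def)
  then have "continuous_on UNIV (\<lambda>t. gnn_output n Ls (G, u) (key t))"
    by (simp add: continuous_map_Euclidean_space_componentwise gnn_output_def)
  then have "((\<lambda>t. gnn_output n Ls (G, u) (key t)) \<longlongrightarrow> gnn_output n Ls (G, u) (key 0)) (at_right 0)"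
    by (simp add: continuous_on_eq_continuous_at isCont_def filterlim_at_split)
  moreover have "gnn_output n Ls (G, u) (key 0) > 0"
    using assms(5) by (simp add: key_def)
  ultimately have "\<forall>\<^sub>F t in at_right 0. gnn_output n Ls (G, u) (key t) > 0"
    by (rule order_tendstoD)
  moreover have "\<forall>\<^sub>F t in at_right 0. keying G (key t)"
    using eventually_inj_on_perturbation[OF G(3)] k by (simp add: keying_def key_def)
  ultimately have "\<forall>\<^sub>F t in at_right 0. keying G (key t) \<and> gnn_output n Ls (G, u) (key t) > 0"
    by eventually_elim simp
  then have "\<exists>t. keying G (key t) \<and> gnn_output n Ls (G, u) (key t) > 0"
    using eventually_happens trivial_limit_at_right_real by blast
  with that show thesis by blast
qed

text \<open>Uniqueness turns any partner of a node into its \<open>f\<close>-value. The forth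
  condition then gives the inclusion from left to right in the last equation, and the back condition
  gives the converse.\<close>

lemma functional_bisimulation_map:
  assumes "functional_bisimulation B (G, u) (H, v)"
  obtains f where "f u = v"
    and "\<And>x. x \<in> verts G \<Longrightarrow> lab G x = lab H (f x)"
    and "\<And>x. x \<in> verts G \<Longrightarrow> f ` {y. (x, y) \<in> edges G} = {w. (f x, w) \<in> edges H}"
proof -
  define f where "f x = (THE y. (x, y) \<in> B)" for x
  have bis: "bisimulation B (G, u) (H, v)"
    and ex1: "\<And>x. x \<in> verts G \<Longrightarrow> \<exists>!y. (x, y) \<in> B"
    using assms(1) by (auto simp: functional_bisimulation_def)
  have fB: "(x, f x) \<in> B" if "x \<in> verts G" for x
    unfolding f_def using ex1[OF that] by (rule theI')
  have B_sub: "B \<subseteq> verts G \<times> verts H"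
    using bis by (simp add: bisimulation_def)
  have f_eq: "y = f x" if "(x, y) \<in> B" for x y
    using that ex1 fB B_sub by blast
  have "f ` {y. (x, y) \<in> edges G} = {w. (f x, w) \<in> edges H}" if "x \<in> verts G" for x
  proof -
    have "\<forall>y. (x, y) \<in> edges G \<longrightarrow> (\<exists>w. (f x, w) \<in> edges H \<and> (y, w) \<in> B)"
      "\<forall>w. (f x, w) \<in> edges H \<longrightarrow> (\<exists>y. (x, y) \<in> edges G \<and> (y, w) \<in> B)"
      using bis fB[OF that] by (auto simp: bisimulation_def)
    then show ?thesis
      using f_eq by blast
  qed
  moreover have "f u = v"
    using bis f_eq by (auto simp: bisimulation_def)
  moreover have "lab G x = lab H (f x)" if "x \<in> verts G" for x
    using bis fB[OF that] by (auto simp: bisimulation_def)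
  ultimately show thesis
    using that by blast
qed

theorem theorem4p3:
  fixes n :: nat and Ls :: "gnn_layer list" and Q :: "('v lgraph \<times> 'v) set"
  assumes "node_query n Q"
    and "gnn n Ls"
    and "local_max Ls"
    and "continuous_combinations Ls"
    and "key_invariant TYPE('v) n Ls"
    and "expresses n Ls Q"
  shows "closed_under_functional_bisimulations n (query_compl n Q)"
proof -
  have "(H, v) \<in> query_compl n Q"
    if GQ: "(G, u) \<in> query_compl n Q" and Hv: "(H, v) \<in> pointed_graphs n"
      and B: "functional_bisimulation B (G, u) (H, v)"
    for G H :: "'v lgraph" and u v B
  proof (rule ccontr)
    assume "(H, v) \<notin> query_compl n Q"
    then have HQ: "(H, v) \<in> Q"
      using Hv by (simp add: query_compl_def)
    have Gu: "(G, u) \<in> pointed_graphs n" "(G, u) \<notin> Q"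
      using GQ by (auto simp: query_compl_def)
    have G: "lgraph n G" "u \<in> verts G" and H: "lgraph n H" "finite (verts H)"
      using Gu Hv by (auto simp: pointed_graphs_def lgraph_def)
    obtain f where f: "f u = v"
      "\<And>x. x \<in> verts G \<Longrightarrow> lab G x = lab H (f x)"
      "\<And>x. x \<in> verts G \<Longrightarrow> f ` {y. (x, y) \<in> edges G} = {w. (f x, w) \<in> edges H}"
      using functional_bisimulation_map[OF B] by blast
    \<comment> \<open>Membership in \<open>Q\<close> speaks about all keyings, so an actual one is
      needed to obtain a positive output.\<close>
    obtain k where "keying H k"
      using finite_imp_keying[OF H(2)] .
    with HQ have "gnn_output n Ls (H, v) k > 0"
      using assms(6) by (auto simp: expresses_def accepts_def)
    moreover have "fold (layer_step G) Ls (init_emb n G (k \<circ> f)) u =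
        fold (layer_step H) Ls (init_emb n H k) (f u)"
    proof (rule fold_layer_step_cover[OF G(1) H(1) f(3) assms(3)])
      show "dims_chain (n + 1) Ls 1" "\<And>L. L \<in> set Ls \<Longrightarrow> gnn_layer L"
        using assms(2) by (auto simp: gnn_def)
      show "init_emb n G (k \<circ> f) x = init_emb n H k (f x)" if "x \<in> verts G" for x
        using f(2)[OF that] by (simp add: init_emb_def fun_eq_iff)
    qed (use G init_emb_in_rvec in auto)
    ultimately have "gnn_output n Ls (G, u) (k \<circ> f) > 0"
      using f(1) by (simp add: gnn_output_def)
    then obtain key where "keying G key" "gnn_output n Ls (G, u) key > 0"
      using positive_output_keying[OF assms(2-4) Gu(1)] by blast
    \<comment> \<open>One accepting keying excludes the rejecting alternative of key invariance, so
      \<open>(G, u)\<close> would belong to \<open>Q\<close>.\<close>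
    then have "\<forall>key. keying G key \<longrightarrow> accepts n Ls (G, u) key"
      using assms(5) Gu(1) by (force simp: key_invariant_def accepts_def)
    then show False
      using Gu assms(6) by (auto simp: expresses_def)
  qed
  then show ?thesis
    unfolding closed_under_functional_bisimulations_def by fast
qed

end
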